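(* Consider a directed unweighted network without self-links on the finite node set $N$. For any node set $A\subseteq N$ with complement $A^{C}=N\setminus A$, the following identities hold over the ring of formal power series in $x$: $$\mathbf{M}_{A^{C}A^{C}}^{\lnot A}=\mathbf{M}_{A^{C}A^{C}}-\mathbf{M}_{A^{C}A}(\mathbf{M}_{AA})^{-1}\mathbf{M}_{AA^{C}}.$$ In particular, the decrease in the number of walks caused by removing the nodes in $A$ is $$\sum_{i,j\in N}m_{ij}-\sum_{i,j\in A^{C}}m_{ij}^{\lnot A}=\mathbf{\mathring{b}}_{A}^{\prime}(\mathbf{M}_{AA})^{-1}\mathbf{\dot{b}}_{A}.$$
   Context: $N=\{1,\dots,n\}$; the network has adjacency matrix $\mathbf{G}=(g_{ij})$ with $g_{ij}\in\{0,1\}$, $g_{ii}=0$, and link set $\mathcal{G}=\{(i,j):g_{ij}=1\}$. A walk is a node sequence $w=(i_0,\dots,i_K)$, $K\ge 0$, with $(i_k,i_{k+1})\in\mathcal{G}$ for $k=0,\dots,K-1$; its length is $K$ (length-zero walks $(i)$ are allowed). $\mathcal{W}_{ij}$ is the set of walks with $i_0=i$ and $i_K=j$. $\mathcal{W}_{ij}(\lnot A)$ is the set of $w=(i_0,\dots,i_K)\in\mathcal{W}_{ij}$ with $i_k\notin A$ for all $k\in\{1,\dots,K-1\}$. For a set of walks $\mathcal{W}'$, $M[[\mathcal{W}';x]]=\sum_{t\ge0}c_t x^t$ (formal power series), where $c_t$ is the number of walks of length $t$ in $\mathcal{W}'$. Set $m_{ij}=M[[\mathcal{W}_{ij};x]]$,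 $m_{ij}^{\lnot A}=M[[\mathcal{W}_{ij}(\lnot A);x]]$, $\mathbf{M}=(m_{ij})_{i,j\in N}$, $\mathbf{M}^{\lnot A}=(m_{ij}^{\lnot A})_{i,j\in N}$. For a matrix $\mathbf{Q}$ indexed by $N$ and $B,C\subseteq N$, $\mathbf{Q}_{BC}$ is the submatrix with rows in $B$ and columns in $C$. Inverses are taken in the ring of matrices over formal power series ($\mathbf{M}_{AA}$ is invertible since its constant term is the identity). $\dot{b}_i=\sum_{j\in N}m_{ij}$, $\mathring{b}_i=\sum_{j\in N}m_{ji}$; $\mathbf{\dot{b}}_A$ and $\mathbf{\mathring{b}}_A$ are the column vectors $(\dot b_i)_{i\in A}$ and $(\mathring b_i)_{i\in A}$, and $^{\prime}$ denotes transpose. *)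

theory Defs
  imports
    "HOL-Algebra.Group"
    "HOL-Computational_Algebra.Formal_Power_Series"
    "Jordan_Normal_Form.Matrix"
    "Jordan_Normal_Form.DL_Submatrix"
begin

(* Matrix indices start at 0, so the node set is {..<n}. *)

definition network :: "nat \<Rightarrow> int mat \<Rightarrow> bool" where
  "network n G \<longleftrightarrow> G \<in> carrier_mat n n
     \<and> (\<forall>i<n. \<forall>j<n. G $$ (i, j) \<in> {0, 1})
     \<and> (\<forall>i<n. G $$ (i, i) = 0)"

definition links :: "int mat \<Rightarrow> (nat \<times> nat) set" where
  "links G = {(i, j). i < dim_row G \<and> j < dim_col G \<and> G $$ (i, j) = 1}"

(* A walk (i_0, ..., i_K) is the list [i_0, ..., i_K], which has K + 1 entries. *)

definition walk_length :: "nat list \<Rightarrow> nat" where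
  "walk_length w = length w - 1"

definition is_walk :: "int mat \<Rightarrow> nat list \<Rightarrow> bool" where
  "is_walk G w \<longleftrightarrow> w \<noteq> [] \<and> set w \<subseteq> {..<dim_row G}
     \<and> (\<forall>k<walk_length w. (w ! k, w ! Suc k) \<in> links G)"

definition walks :: "int mat \<Rightarrow> nat \<Rightarrow> nat \<Rightarrow> nat list set" where
  "walks G i j = {w. is_walk G w \<and> w ! 0 = i \<and> w ! walk_length w = j}"

(* Only the intermediate nodes are restricted; the two end nodes may lie in A. *)

definition walks_avoiding :: "int mat \<Rightarrow> nat set \<Rightarrow> nat \<Rightarrow> nat \<Rightarrow> nat list set" where
  "walks_avoiding G A i j =
     {w \<in> walks G i j. \<forall>k. 1 \<le> k \<and> k < walk_length w \<longrightarrow> w ! k \<notin> A}"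

definition walk_gf :: "nat list set \<Rightarrow> int fps" where
  "walk_gf W = Abs_fps (\<lambda>t. int (card {w \<in> W. walk_length w = t}))"

definition walk_mat :: "int mat \<Rightarrow> int fps mat" where
  "walk_mat G = mat (dim_row G) (dim_row G) (\<lambda>(i, j). walk_gf (walks G i j))"

definition walk_mat_avoiding :: "int mat \<Rightarrow> nat set \<Rightarrow> int fps mat" where
  "walk_mat_avoiding G A =
     mat (dim_row G) (dim_row G) (\<lambda>(i, j). walk_gf (walks_avoiding G A i j))"

definition out_walks :: "int mat \<Rightarrow> int fps vec" where
  "out_walks G = vec (dim_row G) (\<lambda>i. \<Sum>j<dim_row G. walk_mat G $$ (i, j))"

definition in_walks :: "int mat \<Rightarrow> int fps vec" where
  "in_walks G = vec (dim_row G) (\<lambda>i. \<Sum>j<dim_row G. walk_mat G $$ (j, i))"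

(* The analogue of submatrix for vectors: the entries at the positions in I, in increasing order. *)

definition subvec :: "'a vec \<Rightarrow> nat set \<Rightarrow> 'a vec" where
  "subvec v I = vec (card {i. i < dim_vec v \<and> i \<in> I}) (\<lambda>i. v $ pick I i)"

abbreviation fps_mat_ring :: "nat \<Rightarrow> int fps mat ring" where
  "fps_mat_ring k \<equiv> ring_mat TYPE(int fps) k ()"

end

theory Submission
  imports Defs "Jordan_Normal_Form.Determinant"
begin

text \<open>
  Splitting a walk at its first step shows that, for a fixed end node \<open>j \<notin> A\<close>, the series
  \<open>a\<^sub>i = m\<^sub>i\<^sub>j\<^sup>\<not>\<^sup>A\<close> solve \<open>a\<^sub>i = \<delta>\<^sub>i\<^sub>j + x (\<Sum>k\<notin>A. g\<^sub>i\<^sub>k a\<^sub>k)\<close>; a linear system of this shape has only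
  one solution over the power series. The corrected matrix \<open>D = M - M\<^sub>N\<^sub>A (M\<^sub>A\<^sub>A)\<inverse> M\<^sub>A\<^sub>N\<close> vanishes on
  the rows and columns in \<open>A\<close>, so the first-step recurrence of \<open>M\<close> makes its columns outside \<open>A\<close>
  solve the same system. Summing all entries of \<open>M - D\<close> gives the second identity.
\<close>

section \<open>Walks and their decomposition at the first step\<close>

lemma finite_walks_of_length:
  "finite {w \<in> walks_avoiding G A i j. walk_length w = t}"
proof (rule finite_subset)
  show "{w \<in> walks_avoiding G A i j. walk_length w = t}
      \<subseteq> {w. set w \<subseteq> {..<dim_row G} \<and> length w \<le> Suc t}"
    by (auto simp: walks_avoiding_def walks_def is_walk_def walk_length_def)
qed (simp add: finite_lists_length_le)

lemma walks_avoiding_empty [simp]: "walks_avoiding G {} i j = walks G i j"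
  by (simp add: walks_avoiding_def)

lemma walks_avoiding_length_0:
  assumes "i < dim_row G"
  shows "{w \<in> walks_avoiding G A i j. walk_length w = 0} = (if i = j then {[i]} else {})"
proof (rule Set.set_eqI)
  fix w :: "nat list"
  consider "w = []" | k where "w = [k]" | "length w > 1"
    by (cases w; cases "tl w") auto
  then show "w \<in> {w \<in> walks_avoiding G A i j. walk_length w = 0} \<longleftrightarrow>
      w \<in> (if i = j then {[i]} else {})"
  proof cases
    case 2
    with assms show ?thesis
      by (auto simp: walks_avoiding_def walks_def is_walk_def walk_length_def)
  qed (auto simp: walks_avoiding_def walks_def is_walk_def walk_length_def)
qed

text \<open>A link already bounds its source by \<open>dim_row G\<close>, so prepending
  \<open>i\<close> brings no separate range condition; all other positions shift by one.\<close>

lemma Cons_walk_iff: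
  assumes "w \<noteq> []"
  shows "is_walk G (i # w) \<longleftrightarrow> (i, w ! 0) \<in> links G \<and> is_walk G w"
proof -
  have "(\<forall>k < length w. ((i # w) ! k, w ! k) \<in> links G) \<longleftrightarrow>
      (i, w ! 0) \<in> links G \<and> (\<forall>k < length w - 1. (w ! k, w ! Suc k) \<in> links G)"
    using assms by (cases w) (auto simp: All_less_Suc2)
  with assms show ?thesis
    by (auto simp: is_walk_def walk_length_def links_def)
qed

text \<open>After the first step, \<open>k\<close> is the head of the remaining walk, which
  \<open>walks_avoiding\<close> leaves free, so \<open>k \<notin> A\<close> has to be demanded
  separately. For \<open>t = 0\<close> this \<open>k\<close> is the end node \<open>j\<close>
  itself, and \<open>j \<notin> A\<close> keeps the equation true in that case.\<close>

lemma walks_avoiding_length_Suc: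
  assumes "j \<notin> A"
  shows "{w \<in> walks_avoiding G A i j. walk_length w = Suc t} =
    (\<Union>k \<in> {k. (i, k) \<in> links G \<and> k \<notin> A}.
      (#) i ` {w \<in> walks_avoiding G A k j. walk_length w = t})" (is "?L = ?R")
proof (rule Set.set_eqI)
  fix w :: "nat list"
  consider "length w < 2" | a v where "w = a # v" "v \<noteq> []"
    by (cases w; cases "tl w") auto
  then show "w \<in> ?L \<longleftrightarrow> w \<in> ?R"
  proof cases
    case 1
    then show ?thesis
      by (auto simp: walk_length_def walks_avoiding_def walks_def is_walk_def)
  next
    case 2
    define l where "l = length v - 1"
    have len: "length v = Suc l"
      using 2(2) by (simp add: l_def)
    have avoid: "(\<forall>k. 1 \<le> k \<and> k < Suc l \<longrightarrow> (a # v) ! k \<notin> A) \<longleftrightarrow>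
        v ! 0 \<notin> A \<and> (\<forall>k. 1 \<le> k \<and> k < l \<longrightarrow> v ! k \<notin> A)" if "v ! l = j"
    proof
      assume *: "\<forall>k. 1 \<le> k \<and> k < Suc l \<longrightarrow> (a # v) ! k \<notin> A"
      have "v ! 0 \<notin> A"
        using *[rule_format, of 1] that assms by (cases l) auto
      moreover have "v ! k \<notin> A" if "k < l" for k
        using *[rule_format, of "Suc k"] that by auto
      ultimately show "v ! 0 \<notin> A \<and> (\<forall>k. 1 \<le> k \<and> k < l \<longrightarrow> v ! k \<notin> A)"
        by auto
    next
      assume *: "v ! 0 \<notin> A \<and> (\<forall>k. 1 \<le> k \<and> k < l \<longrightarrow> v ! k \<notin> A)"
      show "\<forall>k. 1 \<le> k \<and> k < Suc l \<longrightarrow> (a # v) ! k \<notin> A"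
      proof (intro allI impI)
        fix k assume "1 \<le> k \<and> k < Suc l"
        then show "(a # v) ! k \<notin> A"
          using * by (cases k; cases "k - 1") auto
      qed
    qed
    have "a # v \<in> ?L \<longleftrightarrow> a = i \<and> l = t \<and> (a, v ! 0) \<in> links G \<and> is_walk G v \<and> v ! l = j \<and>
        (\<forall>k. 1 \<le> k \<and> k < Suc l \<longrightarrow> (a # v) ! k \<notin> A)"
      unfolding walks_avoiding_def walks_def mem_Collect_eq Cons_walk_iff[OF 2(2)] walk_length_def
        list.size len by auto
    moreover have "a # v \<in> ?R \<longleftrightarrow> a = i \<and> (i, v ! 0) \<in> links G \<and> v ! 0 \<notin> A \<and> is_walk G v \<and> v ! l = j \<and>
        (\<forall>k. 1 \<le> k \<and> k < l \<longrightarrow> v ! k \<notin> A) \<and> l = t"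
      unfolding walks_avoiding_def walks_def mem_Collect_eq walk_length_def image_iff UN_iff
        list.inject by (auto simp: len)
    ultimately show ?thesis
      unfolding 2(1) using avoid by blast
  qed
qed

section \<open>First-step recurrence of the generating functions\<close>

text \<open>With \<open>A = {}\<close> these are the entries of \<open>walk_mat G\<close>, so a
  single recurrence covers both kinds of walks. Indexing by nodes keeps the algebra free of the
  position shifts caused by submatrices.\<close>

definition avoid_gf :: "int mat \<Rightarrow> nat set \<Rightarrow> nat \<Rightarrow> nat \<Rightarrow> int fps" where
  "avoid_gf G A i j = walk_gf (walks_avoiding G A i j)"

text \<open>Degree zero counts only the walk \<open>[i]\<close>, present when \<open>i = j\<close>.
  In higher degrees the walks are split by their second node: the classes are disjoint, prepending
  \<open>i\<close> is injective, and \<open>fps_X\<close> accounts for the step removed.\<close>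

lemma avoid_gf_first_step:
  assumes "network n G" and "i < n" and "j \<notin> A"
  shows "avoid_gf G A i j = of_bool (i = j) +
    fps_X * (\<Sum>k\<in>{..<n} - A. fps_const (G $$ (i, k)) * avoid_gf G A k j)"
proof (rule fps_ext)
  fix t
  let ?W = "\<lambda>k t. {w \<in> walks_avoiding G A k j. walk_length w = t}"
  have dim: "dim_row G = n" "dim_col G = n"
    using assms(1) by (auto simp: network_def)
  show "fps_nth (avoid_gf G A i j) t = fps_nth (of_bool (i = j) +
    fps_X * (\<Sum>k\<in>{..<n} - A. fps_const (G $$ (i, k)) * avoid_gf G A k j)) t"
  proof (cases t)
    case 0
    then show ?thesis
      using assms(2) dim by (simp add: avoid_gf_def walk_gf_def walks_avoiding_length_0)
  next
    case (Suc s)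
    let ?K = "{k. (i, k) \<in> links G \<and> k \<notin> A}"
    have K: "?K = {k \<in> {..<n} - A. G $$ (i, k) = 1}"
      using assms(2) dim by (auto simp: links_def)
    have "card (?W i t) = card (\<Union>k\<in>?K. (#) i ` ?W k s)"
      using assms(3) by (simp add: Suc walks_avoiding_length_Suc)
    also have "\<dots> = (\<Sum>k\<in>?K. card ((#) i ` ?W k s))"
    proof (rule card_UN_disjoint)
      show "\<forall>k\<in>?K. \<forall>l\<in>?K. k \<noteq> l \<longrightarrow> (#) i ` ?W k s \<inter> (#) i ` ?W l s = {}"
        by (auto simp: walks_avoiding_def walks_def)
    qed (auto simp: K finite_walks_of_length)
    also have "\<dots> = (\<Sum>k\<in>?K. card (?W k s))"
      by (simp add: card_image)
    finally have "int (card (?W i t)) = (\<Sum>k\<in>?K. int (card (?W k s)))"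
      by simp
    also have "\<dots> = (\<Sum>k\<in>{..<n} - A. if G $$ (i, k) = 1 then int (card (?W k s)) else 0)"
      unfolding K by (rule sum.inter_filter) simp
    \<comment> \<open>The entries are 0 or 1, so the link condition acts as a factor.\<close>
    also have "\<dots> = (\<Sum>k\<in>{..<n} - A. G $$ (i, k) * int (card (?W k s)))"
      using assms(1,2) by (intro sum.cong) (auto simp: network_def)
    finally show ?thesis
      by (simp add: Suc avoid_gf_def walk_gf_def fps_sum_nth del: of_nat_sum)
  qed
qed

section \<open>Uniqueness of solutions and the corrected matrix\<close>

text \<open>Iterating the equation shows that \<open>f\<close> is divisible by every power of the indeterminate.\<close>

lemma fps_X_linear_system_trivial:
  fixes f :: "'a \<Rightarrow> 'b::comm_ring_1 fps"
  assumes "\<And>i. i \<in> S \<Longrightarrow> f i = fps_X * (\<Sum>k\<in>S. c i k * f k)" and "i \<in> S"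
  shows "f i = 0"
proof -
  have "\<forall>i\<in>S. fps_nth (f i) t = 0" for t
  proof (induction t rule: less_induct)
    case (less t)
    show ?case
    proof
      fix i assume "i \<in> S"
      show "fps_nth (f i) t = 0"
      proof (cases t)
        case 0
        then show ?thesis
          by (subst assms(1)[OF \<open>i \<in> S\<close>]) simp
      next
        case (Suc s)
        \<comment> \<open>The factor \<open>fps_X\<close> shifts degrees by one, so degree
          \<open>Suc s\<close> involves only coefficients of the \<open>f k\<close> up to degree
          \<open>s\<close>, which vanish by induction.\<close>
        then show ?thesis
          using less
          by (subst assms(1)[OF \<open>i \<in> S\<close>])
            (auto simp: fps_sum_nth fps_mult_nth intro!: sum.neutral)
      qed
    qed
  qed
  with assms(2) show ?thesis
    by (auto intro: fps_ext)
qed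

text \<open>Here \<open>v\<close> is a two-sided inverse of the block of walks within
  \<open>A\<close>, indexed by nodes: the right inverse law kills the rows of \<open>d\<close> in
  \<open>A\<close>, the left one the columns. Taking \<open>d\<close> on all nodes, not just outside
  \<open>A\<close>, makes these zeros available both for the recurrence and for summing all
  entries.\<close>

lemma avoid_gf_eq_corrected:
  fixes v :: "nat \<Rightarrow> nat \<Rightarrow> int fps"
  assumes net: "network n G" and A: "A \<subseteq> {..<n}"
    and right: "\<And>p r. p \<in> A \<Longrightarrow> r \<in> A \<Longrightarrow>
      (\<Sum>q\<in>A. avoid_gf G {} p q * v q r) = of_bool (p = r)"
    and left: "\<And>p r. p \<in> A \<Longrightarrow> r \<in> A \<Longrightarrow>
      (\<Sum>q\<in>A. v p q * avoid_gf G {} q r) = of_bool (p = r)"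
    and ij: "i < n" "j < n"
  defines "d \<equiv> \<lambda>i j. avoid_gf G {} i j
      - (\<Sum>p\<in>A. \<Sum>q\<in>A. avoid_gf G {} i p * v p q * avoid_gf G {} q j)"
  shows "d i j = (if i \<in> A \<or> j \<in> A then 0 else avoid_gf G A i j)"
proof -
  let ?m = "avoid_gf G {}"
  let ?g = "\<lambda>i k. fps_const (G $$ (i, k))"
  have fin: "finite A"
    using A finite_subset by blast
  have row: "d i j = 0" if "i \<in> A" for i j
  proof -
    have "(\<Sum>p\<in>A. \<Sum>q\<in>A. ?m i p * v p q * ?m q j) = (\<Sum>q\<in>A. (\<Sum>p\<in>A. ?m i p * v p q) * ?m q j)"
      by (subst sum.swap) (simp add: sum_distrib_right)
    also have "\<dots> = ?m i j"
      using that fin by (simp add: right sum_of_bool_mult_eq)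
    finally show ?thesis
      by (simp add: d_def)
  qed
  have col: "d i j = 0" if "j \<in> A"
  proof -
    have "(\<Sum>p\<in>A. \<Sum>q\<in>A. ?m i p * v p q * ?m q j) = (\<Sum>p\<in>A. ?m i p * (\<Sum>q\<in>A. v p q * ?m q j))"
      by (simp add: sum_distrib_left mult.assoc)
    also have "\<dots> = ?m i j"
      using that fin by (simp add: left sum_mult_of_bool_eq)
    finally show ?thesis
      by (simp add: d_def)
  qed
  have step: "d i j = of_bool (i = j) + fps_X * (\<Sum>k\<in>{..<n} - A. ?g i k * d k j)"
    if i: "i < n" "i \<notin> A" for i
  proof -
    define s where "s = (\<lambda>l. \<Sum>k<n. ?g i k * ?m k l)"
    have m: "?m i l = of_bool (i = l) + fps_X * s l" for l
      using avoid_gf_first_step[OF net i(1), of l "{}"] by (simp add: s_def)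
    \<comment> \<open>Since \<open>i\<close> lies outside \<open>A\<close> and \<open>p\<close>
      inside, the Kronecker term in the recurrence for \<open>?m i p\<close> is zero.\<close>
    have "(\<Sum>p\<in>A. \<Sum>q\<in>A. ?m i p * v p q * ?m q j) = (\<Sum>p\<in>A. \<Sum>q\<in>A. fps_X * s p * v p q * ?m q j)"
      using i(2) by (intro sum.cong refl) (subst m, auto)
    also have "\<dots> = fps_X * (\<Sum>p\<in>A. \<Sum>q\<in>A. s p * v p q * ?m q j)"
      by (simp add: sum_distrib_left mult.assoc)
    also have "(\<Sum>p\<in>A. \<Sum>q\<in>A. s p * v p q * ?m q j)
        = (\<Sum>k<n. ?g i k * (\<Sum>p\<in>A. \<Sum>q\<in>A. ?m k p * v p q * ?m q j))"
    proof -
      have "(\<Sum>p\<in>A. \<Sum>q\<in>A. s p * v p q * ?m q j)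
          = (\<Sum>p\<in>A. \<Sum>q\<in>A. \<Sum>k<n. ?g i k * (?m k p * v p q * ?m q j))"
        by (simp add: s_def sum_distrib_right mult.assoc)
      also have "\<dots> = (\<Sum>p\<in>A. \<Sum>k<n. \<Sum>q\<in>A. ?g i k * (?m k p * v p q * ?m q j))"
        by (intro sum.cong refl sum.swap)
      also have "\<dots> = (\<Sum>k<n. \<Sum>p\<in>A. \<Sum>q\<in>A. ?g i k * (?m k p * v p q * ?m q j))"
        by (rule sum.swap)
      finally show ?thesis
        by (simp add: sum_distrib_left)
    qed
    finally have "d i j = of_bool (i = j) + fps_X * (\<Sum>k<n. ?g i k * d k j)"
      unfolding d_def by (subst m) (simp add: s_def algebra_simps sum_subtractf)
    \<comment> \<open>The vanishing rows remove the nodes in \<open>A\<close> from the sum, which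
      turns the recurrence for all walks into the one for avoiding walks.\<close>
    also have "(\<Sum>k<n. ?g i k * d k j) = (\<Sum>k\<in>{..<n} - A. ?g i k * d k j)"
      using row by (intro sum.mono_neutral_right) auto
    finally show ?thesis .
  qed
  \<comment> \<open>In the difference the Kronecker terms cancel, leaving a homogeneous system over
    the nodes outside \<open>A\<close>.\<close>
  have "d i j - avoid_gf G A i j = 0" if "i \<notin> A" "j \<notin> A"
  proof (rule fps_X_linear_system_trivial[where f = "\<lambda>i. d i j - avoid_gf G A i j"])
    show "i \<in> {..<n} - A"
      using that ij by simp
  next
    fix i assume "i \<in> {..<n} - A"
    then show "d i j - avoid_gf G A i j
        = fps_X * (\<Sum>k\<in>{..<n} - A. ?g i k * (d k j - avoid_gf G A k j))"
      using step[of i] avoid_gf_first_step[OF net, of i j A] that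
      by (simp add: algebra_simps sum_subtractf)
  qed
  with row col show ?thesis
    by auto
qed

section \<open>Invertibility and reindexing\<close>

text \<open>Taking constant terms is a ring homomorphism, so \<open>det B\<close> has constant term
  1 and is a unit; its inverse times the adjugate inverts \<open>B\<close>. The argument 1 of
  \<open>fps_right_inverse\<close> is the constant term of that inverse.\<close>

lemma fps_mat_Units:
  assumes B: "B \<in> carrier_mat k k" and unit: "\<And>i j. i < k \<Longrightarrow> j < k \<Longrightarrow> fps_nth (B $$ (i, j)) 0 = of_bool (i = j)"
  shows "B \<in> Units (fps_mat_ring k)"
proof -
  have "fps_nth (det B) 0 = det (map_mat (\<lambda>f. fps_nth f 0) B)"
  proof -
    interpret comm_ring_hom "\<lambda>f :: int fps. fps_nth f 0"
      by unfold_locales simp_all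
    show ?thesis
      by (rule hom_det[symmetric])
  qed
  also have "map_mat (\<lambda>f. fps_nth f 0) B = 1\<^sub>m k"
    using B unit by (intro eq_matI) auto
  finally have "fps_nth (det B) 0 = 1"
    by simp
  then have "det B * fps_right_inverse (det B) 1 = 1"
    by (intro fps_right_inverse) simp
  then have *: "fps_right_inverse (det B) 1 * det B = 1"
    by (simp add: mult.commute)
  have unit: "fps_right_inverse (det B) 1 \<cdot>\<^sub>m (det B \<cdot>\<^sub>m 1\<^sub>m k) = 1\<^sub>m k"
    by (intro eq_matI) (auto simp: *)
  let ?C = "fps_right_inverse (det B) 1 \<cdot>\<^sub>m adj_mat B"
  note adj = adj_mat[OF B]
  have "?C * B = 1\<^sub>m k" "B * ?C = 1\<^sub>m k"
    using adj B unit by (simp_all add: mult_smult_distrib mult_smult_assoc_mat[of _ k k _ k])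
  moreover have "?C \<in> carrier_mat k k"
    using adj by simp
  ultimately show ?thesis
    using B unfolding Units_def ring_mat_simps by blast
qed

text \<open>The inverse of \<open>pick A\<close> sends an element to its rank, the number of smaller
  elements of \<open>A\<close>. The function takes both node and position because walk series are
  indexed by nodes and the inverse matrix by positions.\<close>

lemma sum_pick:
  assumes "finite A"
  shows "(\<Sum>a = 0..<card A. f (pick A a) a) = (\<Sum>p\<in>A. f p (card {x \<in> A. x < p}))"
proof (rule sum.reindex_bij_witness[where i = "\<lambda>p. card {x \<in> A. x < p}" and j = "pick A"])
  fix p assume "p \<in> A"
  then show "card {x \<in> A. x < p} \<in> {0..<card A}"
    using assms by (auto intro!: psubset_card_mono)
qed (auto simp: pick_card_in_set pick_in_set_le card_pick_le)

section \<open>From node-indexed series to submatrices\<close>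

theorem proposition1:
  fixes n :: nat and G :: "int mat" and A :: "nat set"
  assumes "network n G"
    and "A \<subseteq> {..<n}"
  shows "let AC = {..<n} - A;
             M = walk_mat G;
             MA = walk_mat_avoiding G A;
             R = fps_mat_ring (card A)
         in submatrix M A A \<in> Units R
            \<and> submatrix MA AC AC =
                submatrix M AC AC
                  - submatrix M AC A * inv\<^bsub>R\<^esub> (submatrix M A A) * submatrix M A AC
            \<and> (\<Sum>i<n. \<Sum>j<n. M $$ (i, j)) - (\<Sum>i\<in>AC. \<Sum>j\<in>AC. MA $$ (i, j)) =
                subvec (in_walks G) A
                  \<bullet> (inv\<^bsub>R\<^esub> (submatrix M A A) *\<^sub>v subvec (out_walks G) A)"
proof -
  define AC where "AC = {..<n} - A"
  define M where "M = walk_mat G"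
  define MA where "MA = walk_mat_avoiding G A"
  define R where "R = fps_mat_ring (card A)"
  define V where "V = inv\<^bsub>R\<^esub> (submatrix M A A)"
  define rk where "rk = (\<lambda>p. card {x \<in> A. x < p})"
  \<comment> \<open>This is the inverse matrix \<open>V\<close> with positions replaced by the nodes
    of \<open>A\<close> that they stand for.\<close>
  define v where "v = (\<lambda>p q. V $$ (rk p, rk q))"
  let ?m = "avoid_gf G {}"
  define h where "h = (\<lambda>i j. \<Sum>p\<in>A. \<Sum>q\<in>A. ?m i p * v p q * ?m q j)"
  note net = assms(1) and A = assms(2)
  have fin: "finite A" "finite AC"
    using A finite_subset by (auto simp: AC_def)
  have dimG: "dim_row G = n"
    using net by (auto simp: network_def)
  have cards: "{i. i < n \<and> i \<in> A} = A" "{i. i < n \<and> i \<in> AC} = AC"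
    using A by (auto simp: AC_def)
  have M: "M \<in> carrier_mat n n" "MA \<in> carrier_mat n n"
    and Mij: "\<And>i j. i < n \<Longrightarrow> j < n \<Longrightarrow> M $$ (i, j) = ?m i j"
    and MAij: "\<And>i j. i < n \<Longrightarrow> j < n \<Longrightarrow> MA $$ (i, j) = avoid_gf G A i j"
    by (simp_all add: M_def MA_def walk_mat_def walk_mat_avoiding_def avoid_gf_def dimG)
  have pickA: "pick A a \<in> A" "pick A a < n" if "a < card A" for a
    using pick_in_set_le[OF that] A by auto
  have pickAC: "pick AC a \<in> AC" "pick AC a < n" if "a < card AC" for a
    using pick_in_set_le[OF that] by (auto simp: AC_def)
  have sub: "submatrix M A A \<in> carrier_mat (card A) (card A)"
      "submatrix M AC A \<in> carrier_mat (card AC) (card A)"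
      "submatrix M A AC \<in> carrier_mat (card A) (card AC)"
      "submatrix M AC AC \<in> carrier_mat (card AC) (card AC)"
      "submatrix MA AC AC \<in> carrier_mat (card AC) (card AC)"
    using M by (auto simp: dim_submatrix cards)
  have idx: "submatrix B I J $$ (a, b) = B $$ (pick I a, pick J b)"
    if "B \<in> carrier_mat n n" "I \<in> {A, AC}" "J \<in> {A, AC}" "a < card I" "b < card J" for B :: "int fps mat" and I J a b
    using that by (subst submatrix_index) (auto simp: cards)
  have unit: "submatrix M A A \<in> Units R"
    unfolding R_def
  proof (rule fps_mat_Units[OF sub(1)])
    fix a b assume ab: "a < card A" "b < card A"
    \<comment> \<open>In degree zero the recurrence leaves only the Kronecker term.\<close>
    have "fps_nth (?m i j) 0 = of_bool (i = j)" if "i < n" for i j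
      using avoid_gf_first_step[OF net that, of j "{}"] by simp
    moreover have "pick A a = pick A b \<longleftrightarrow> a = b"
      using card_pick_le ab by metis
    ultimately show "fps_nth (submatrix M A A $$ (a, b)) 0 = of_bool (a = b)"
      using ab pickA by (simp add: idx M Mij)
  qed
  interpret R: ring R
    unfolding R_def by (rule ring_mat)
  have V: "V \<in> carrier_mat (card A) (card A)"
    using R.Units_inv_closed[OF unit] by (simp add: V_def R_def ring_mat_simps)
  have inv: "submatrix M A A * V = 1\<^sub>m (card A)" "V * submatrix M A A = 1\<^sub>m (card A)"
    using R.Units_r_inv[OF unit] R.Units_l_inv[OF unit] by (simp_all add: V_def R_def ring_mat_simps)
  have rk: "rk p < card A" "pick A (rk p) = p" if "p \<in> A" for p
    using that fin by (auto simp: rk_def pick_card_in_set intro!: psubset_card_mono)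
  have rk_eq: "rk p = rk q \<longleftrightarrow> p = q" if "p \<in> A" "q \<in> A" for p q
    using rk(2) that by metis
  have sum_rk: "(\<Sum>a = 0..<card A. f (pick A a) a) = (\<Sum>p\<in>A. f p (rk p))" for f :: "nat \<Rightarrow> nat \<Rightarrow> int fps"
    unfolding rk_def by (rule sum_pick[OF fin(1)])
  have right: "(\<Sum>q\<in>A. ?m p q * v q r) = of_bool (p = r)" if "p \<in> A" "r \<in> A" for p r
  proof -
    have "(\<Sum>q\<in>A. ?m p q * v q r) = (\<Sum>a = 0..<card A. ?m p (pick A a) * V $$ (a, rk r))"
      unfolding v_def by (rule sum_rk[symmetric])
    also have "\<dots> = (submatrix M A A * V) $$ (rk p, rk r)"
      using that rk sub V A pickA by (auto simp: scalar_prod_def idx M Mij intro!: sum.cong)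
    finally show ?thesis
      using that rk rk_eq by (simp add: inv)
  qed
  have left: "(\<Sum>q\<in>A. v p q * ?m q r) = of_bool (p = r)" if "p \<in> A" "r \<in> A" for p r
  proof -
    have "(\<Sum>q\<in>A. v p q * ?m q r) = (\<Sum>a = 0..<card A. V $$ (rk p, a) * ?m (pick A a) r)"
      unfolding v_def by (rule sum_rk[symmetric])
    also have "\<dots> = (V * submatrix M A A) $$ (rk p, rk r)"
      using that rk sub V A pickA by (auto simp: scalar_prod_def idx M Mij intro!: sum.cong)
    finally show ?thesis
      using that rk rk_eq by (simp add: inv)
  qed
  have corr: "?m i j - h i j = (if i \<in> A \<or> j \<in> A then 0 else avoid_gf G A i j)"
    if "i < n" "j < n" for i j
    unfolding h_def by (rule avoid_gf_eq_corrected[OF net A right left that])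

  \<comment> \<open>The block identity\<close>
  have schur: "submatrix MA AC AC = submatrix M AC AC - submatrix M AC A * V * submatrix M A AC"
  proof (rule eq_matI)
    fix a b
    assume "a < dim_row (submatrix M AC AC - submatrix M AC A * V * submatrix M A AC)"
      "b < dim_col (submatrix M AC AC - submatrix M AC A * V * submatrix M A AC)"
    then have ab: "a < card AC" "b < card AC"
      using sub by auto
    note pab = pickAC[OF ab(1)] pickAC[OF ab(2)]
    have "(submatrix M AC A * V * submatrix M A AC) $$ (a, b)
        = (\<Sum>d = 0..<card A. (\<Sum>c = 0..<card A. ?m (pick AC a) (pick A c) * V $$ (c, d)) * ?m (pick A d) (pick AC b))"
      using ab sub V pickA pab by (auto simp: scalar_prod_def idx M Mij simp del: assoc_mult_mat intro!: sum.cong)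
    \<comment> \<open>The two sums over positions become sums over nodes one at a time, the outer
      one first.\<close>
    also have "\<dots> = (\<Sum>q\<in>A. (\<Sum>c = 0..<card A. ?m (pick AC a) (pick A c) * V $$ (c, rk q)) * ?m q (pick AC b))"
      by (rule sum_rk)
    also have "\<dots> = (\<Sum>q\<in>A. (\<Sum>p\<in>A. ?m (pick AC a) p * v p q) * ?m q (pick AC b))"
      unfolding v_def by (simp only: sum_rk[of "\<lambda>p c. ?m (pick AC a) p * V $$ (c, rk _)"])
    also have "\<dots> = h (pick AC a) (pick AC b)"
      unfolding h_def by (subst sum.swap) (simp add: sum_distrib_right)
    finally show "submatrix MA AC AC $$ (a, b) =
        (submatrix M AC AC - submatrix M AC A * V * submatrix M A AC) $$ (a, b)"
      using ab sub V pab corr[OF pab(2,4)] by (simp add: idx M Mij MAij AC_def)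
  qed (use sub in auto)

  \<comment> \<open>The number of walks lost\<close>
  have "(\<Sum>i<n. \<Sum>j<n. M $$ (i, j)) - (\<Sum>i\<in>AC. \<Sum>j\<in>AC. MA $$ (i, j)) = (\<Sum>i<n. \<Sum>j<n. h i j)"
  proof -
    have "(\<Sum>i\<in>AC. \<Sum>j\<in>AC. MA $$ (i, j)) = (\<Sum>i\<in>AC. \<Sum>j\<in>AC. ?m i j - h i j)"
      using corr by (intro sum.cong) (auto simp: AC_def MAij)
    \<comment> \<open>By \<open>corr\<close> the terms with an index in \<open>A\<close> are zero,
      so both ranges extend to all nodes and only the total of \<open>h\<close> survives.\<close>
    also have "\<dots> = (\<Sum>i\<in>AC. \<Sum>j<n. ?m i j - h i j)"
      using corr by (intro sum.cong sum.mono_neutral_left) (auto simp: AC_def)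
    also have "\<dots> = (\<Sum>i<n. \<Sum>j<n. ?m i j - h i j)"
      using corr by (intro sum.mono_neutral_left) (auto simp: AC_def)
    finally show ?thesis
      by (simp add: Mij sum_subtractf)
  qed
  \<comment> \<open>Summing over the end nodes first factors each term: column \<open>p\<close>
    gives an entry of \<open>in_walks G\<close> and row \<open>q\<close> one of
    \<open>out_walks G\<close>.\<close>
  also have "\<dots> = (\<Sum>p\<in>A. \<Sum>q\<in>A. (\<Sum>i<n. ?m i p) * v p q * (\<Sum>j<n. ?m q j))"
  proof -
    have "(\<Sum>i<n. \<Sum>j<n. h i j) = (\<Sum>p\<in>A. \<Sum>q\<in>A. \<Sum>i<n. \<Sum>j<n. ?m i p * v p q * ?m q j)"
      by (simp only: h_def sum.swap[of _ A "{..<n}"])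
    then show ?thesis
      by (simp only: sum_distrib_right) (simp only: sum_distrib_left)
  qed
  also have "\<dots> = (\<Sum>p\<in>A. (\<Sum>i<n. ?m i p) * (\<Sum>q\<in>A. v p q * (\<Sum>j<n. ?m q j)))"
    by (simp only: sum_distrib_left[where A = A] mult.assoc)
  also have "\<dots> = (\<Sum>p\<in>A. (\<Sum>i<n. ?m i p) * (\<Sum>b = 0..<card A. V $$ (rk p, b) * (\<Sum>j<n. ?m (pick A b) j)))"
    unfolding v_def by (simp only: sum_rk[of "\<lambda>q b. V $$ (rk _, b) * (\<Sum>j<n. ?m q j)"])
  also have "\<dots> = (\<Sum>a = 0..<card A. (\<Sum>i<n. ?m i (pick A a)) *
      (\<Sum>b = 0..<card A. V $$ (a, b) * (\<Sum>j<n. ?m (pick A b) j)))"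
    by (rule sum_rk[symmetric])
  also have "\<dots> = subvec (in_walks G) A \<bullet> (V *\<^sub>v subvec (out_walks G) A)"
    using V pickA
    by (auto simp: scalar_prod_def subvec_def in_walks_def out_walks_def dimG cards
        M_def[symmetric] Mij intro!: sum.cong)
  finally show ?thesis
    using unit schur unfolding Let_def AC_def M_def MA_def R_def V_def by blast
qed

end
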